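(* Let $q\ge 1$ be an integer and let $\alpha\in\mathbb{R}$ with $\alpha\neq 1$. Put $K(0)=\alpha$ and consider the system of $q$ linear equations in the unknowns $K(1),\ldots,K(q)\in\mathbb{R}$: $$\sum_{j=1}^q K(j)=\frac{1-\alpha}{2},\qquad \sum_{j=1}^q j^{2r}K(j)=0\quad\text{for } r=1,\ldots,q-1.$$ This system has the unique solution $$K(j)=\frac{1-\alpha}{2}\left(\frac{q!}{j}\right)^2\frac{1}{\prod_{1\le l\le q,\ l\neq j}(l^2-j^2)},\qquad j=1,\ldots,q.$$ Further, extending this solution by symmetry, $K(-j)=K(j)$ for $j=1,\ldots,q$, one has $$\sum_{j=-q}^q j^{2q}K(j)=(1-\alpha)(q!)^2(-1)^{q+1}\neq 0.$$
   Context: An empty product equals $1$. When $q=1$ the system consists only of the first equation. *)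

theory Defs
  imports Complex_Main
begin

text \<open>
  The unknowns are \<open>K 1, \<dots>, K q\<close>; values of \<open>K\<close> outside \<open>{1..q}\<close> are irrelevant.
  For \<open>q = 1\<close> the index set \<open>{1..q - 1}\<close> is empty, so only the first equation remains.
\<close>

definition solves_system :: "nat \<Rightarrow> real \<Rightarrow> (nat \<Rightarrow> real) \<Rightarrow> bool" where
  "solves_system q \<alpha> K \<longleftrightarrow>
     (\<Sum>j=1..q. K j) = (1 - \<alpha>) / 2 \<and>
     (\<forall>r\<in>{1..q - 1}. (\<Sum>j=1..q. real j ^ (2 * r) * K j) = 0)"

definition solution :: "nat \<Rightarrow> real \<Rightarrow> nat \<Rightarrow> real" where
  "solution q \<alpha> j =
     (1 - \<alpha>) / 2 * (fact q / real j)\<^sup>2 * (1 / (\<Prod>l\<in>{1..q} - {j}. (real l)\<^sup>2 - (real j)\<^sup>2))"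

text \<open>The extension of \<open>K 1, \<dots>, K q\<close> to negative indices by symmetry, with value \<open>\<alpha>\<close> at \<open>0\<close>.\<close>

definition symmetric_extension :: "real \<Rightarrow> (nat \<Rightarrow> real) \<Rightarrow> int \<Rightarrow> real" where
  "symmetric_extension \<alpha> K j = (if j = 0 then \<alpha> else K (nat \<bar>j\<bar>))"

end

theory Submission
  imports Defs "HOL-Computational_Algebra.Polynomial"
begin

text \<open>
  With nodes \<open>x\<^sub>j = j\<^sup>2\<close>, the system says that the functional \<open>p \<mapsto> \<Sum>\<^sub>j p(x\<^sub>j) K(j)\<close> equals
  \<open>p \<mapsto> (1 - \<alpha>) / 2 \<cdot> p(0)\<close> on polynomials of degree less than \<open>q\<close>. By Lagrange interpolation
  this holds exactly when \<open>K(j) = (1 - \<alpha>) / 2 \<cdot> L\<^sub>j(0)\<close> for the Lagrange basis polynomials \<open>L\<^sub>j\<close>.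
  The final sum is the functional at \<open>X\<^sup>q\<close>, which agrees on the nodes with
  \<open>X\<^sup>q - \<Prod>\<^sub>j (X - x\<^sub>j)\<close>, a polynomial of degree less than \<open>q\<close>.
\<close>

text \<open>Nodes form a family over an index set, so that the index \<open>j\<close> and its node,
  later \<open>(real j)\<^sup>2\<close>, stay apart.\<close>

definition lagrange_basis :: "'i set \<Rightarrow> ('i \<Rightarrow> 'a::field) \<Rightarrow> 'i \<Rightarrow> 'a poly" where
  "lagrange_basis A x j =
     smult (1 / (\<Prod>l\<in>A - {j}. x j - x l)) (\<Prod>l\<in>A - {j}. [:- x l, 1:])"

lemma poly_lagrange_basis:
  "poly (lagrange_basis A x j) y = (\<Prod>l\<in>A - {j}. (y - x l) / (x j - x l))"
  by (simp add: lagrange_basis_def poly_prod prod_dividef)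

lemma degree_prod_linear:
  fixes x :: "'i \<Rightarrow> 'a::idom"
  assumes "finite A"
  shows "degree (\<Prod>l\<in>A. [:- x l, 1:]) = card A"
  by (subst degree_prod_sum_eq) auto

lemma degree_lagrange_basis:
  assumes "finite A" "j \<in> A"
  shows "degree (lagrange_basis A x j) < card A"
proof -
  have "degree (lagrange_basis A x j) \<le> card (A - {j})"
    unfolding lagrange_basis_def
    using degree_smult_le degree_prod_linear[of "A - {j}" x] assms by (metis finite_Diff)
  then show ?thesis
    using assms card_Diff1_less[of A j] by linarith
qed

text \<open>For \<open>k \<noteq> j\<close> the factor with \<open>l = k\<close> vanishes; for
  \<open>k = j\<close> injectivity keeps every denominator nonzero, so each factor is 1.\<close>

lemma poly_lagrange_basis_node:
  assumes "finite A" "inj_on x A" "j \<in> A" "k \<in> A"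
  shows "poly (lagrange_basis A x j) (x k) = (if j = k then 1 else 0)"
proof (cases "j = k")
  case True
  have "(\<Prod>l\<in>A - {j}. (x j - x l) / (x j - x l)) = 1"
    using assms by (intro prod.neutral) (auto dest: inj_onD)
  with True show ?thesis by (simp add: poly_lagrange_basis)
next
  case False
  then show ?thesis
    using assms by (auto simp: poly_lagrange_basis)
qed

text \<open>Both sides, as polynomials in \<open>y\<close>, have degree below \<open>card A\<close>
  and agree at the \<open>card A\<close> distinct nodes.\<close>

theorem lagrange_interpolation:
  fixes x :: "'i \<Rightarrow> 'a::field"
  assumes "finite A" "inj_on x A" "degree p < card A"
  shows "poly p y = (\<Sum>j\<in>A. poly p (x j) * poly (lagrange_basis A x j) y)"
proof -
  define r where "r = (\<Sum>j\<in>A. smult (poly p (x j)) (lagrange_basis A x j))"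
  have "p = r"
  proof (rule poly_eqI_degree[of "x ` A"])
    show "poly p z = poly r z" if "z \<in> x ` A" for z
      using that assms
      by (auto simp: r_def poly_sum poly_lagrange_basis_node if_distrib sum.delta cong: if_cong)
    show "degree p < card (x ` A)"
      using assms by (simp add: card_image)
    show "degree r < card (x ` A)"
      unfolding r_def card_image[OF assms(2)] using assms
      by (intro degree_sum_less le_less_trans[OF degree_smult_le] degree_lagrange_basis) auto
  qed
  then have "poly p y = poly r y"
    by simp
  then show ?thesis
    by (simp add: r_def poly_sum)
qed

text \<open>This is the first degree at which interpolation fails to be exact; the error is the
  monic nodal polynomial \<open>w\<close>, which vanishes at all nodes.\<close>

lemma lagrange_interpolation_monomial_card:
  fixes x :: "'i \<Rightarrow> 'a::field"
  assumes "finite A" "A \<noteq> {}" "inj_on x A"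
  shows "(\<Sum>j\<in>A. x j ^ card A * poly (lagrange_basis A x j) y)
    = y ^ card A - (\<Prod>l\<in>A. y - x l)"
proof -
  define w where "w = (\<Prod>l\<in>A. [:- x l, 1:])"
  define p where "p = monom 1 (card A) - w"
  have deg_w: "degree w = card A"
    unfolding w_def by (rule degree_prod_linear) fact
  have "lead_coeff w = 1"
    unfolding w_def by (simp add: lead_coeff_prod)
  then have "coeff p (card A) = 0"
    by (simp add: p_def deg_w)
  moreover have "degree p \<le> card A"
    unfolding p_def by (intro degree_diff_le) (simp_all add: degree_monom_le deg_w)
  \<comment> \<open>If \<open>degree p\<close> were \<open>card A\<close>, the vanishing coefficient
    would force \<open>p = 0\<close>, whose degree is 0 by convention; positivity rules this
    out.\<close>
  moreover have "card A > 0"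
    using assms by (simp add: card_gt_0_iff)
  ultimately have "degree p < card A"
    by (metis degree_0 leading_coeff_0_iff order_le_less)
  moreover have "poly p (x j) = x j ^ card A" if "j \<in> A" for j
    using that assms(1) by (auto simp: p_def w_def poly_monom poly_prod)
  ultimately have "poly p y = (\<Sum>j\<in>A. x j ^ card A * poly (lagrange_basis A x j) y)"
    using lagrange_interpolation[OF assms(1,3), of p y] by simp
  then show ?thesis
    by (simp add: p_def w_def poly_monom poly_prod)
qed

lemma inj_on_real_square: "inj_on (\<lambda>j::nat. (real j)\<^sup>2) A"
  by (auto intro!: inj_onI simp: power2_eq_iff)

text \<open>Cancelling \<open>j\<close> from the factorial leaves the product of the other indices,
  whose square supplies the numerators of the basis polynomial at 0, up to signs.\<close>

lemma solution_eq_lagrange_basis: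
  assumes "j \<in> {1..q}"
  shows "solution q \<alpha> j = (1 - \<alpha>) / 2 * poly (lagrange_basis {1..q} (\<lambda>j. (real j)\<^sup>2) j) 0"
proof -
  have "(fact q :: real) = real j * (\<Prod>l\<in>{1..q} - {j}. real l)"
    using prod.remove[of "{1..q}" j real] assms by (simp add: fact_prod)
  then have "fact q / real j = (\<Prod>l\<in>{1..q} - {j}. real l)"
    using assms by simp
  then have "(fact q / real j)\<^sup>2 * (1 / (\<Prod>l\<in>{1..q} - {j}. (real l)\<^sup>2 - (real j)\<^sup>2))
      = (\<Prod>l\<in>{1..q} - {j}. (real l)\<^sup>2 / ((real l)\<^sup>2 - (real j)\<^sup>2))"
    by (simp add: prod_dividef prod_power_distrib)
  \<comment> \<open>Numerator and denominator change sign together in each factor.\<close>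
  also have "\<dots> = (\<Prod>l\<in>{1..q} - {j}. (0 - (real l)\<^sup>2) / ((real j)\<^sup>2 - (real l)\<^sup>2))"
    by (intro prod.cong refl) (metis diff_0 minus_diff_eq minus_divide_divide)
  finally show ?thesis
    unfolding solution_def poly_lagrange_basis mult.assoc by (rule arg_cong)
qed

text \<open>The equations are the cases \<open>p = monom 1 r\<close> with \<open>r < q\<close>, and
  both sides are linear in \<open>p\<close>.\<close>

lemma solves_system_iff:
  assumes "q \<ge> 1"
  shows "solves_system q \<alpha> K \<longleftrightarrow>
    (\<forall>p. degree p < q \<longrightarrow> (\<Sum>j=1..q. poly p ((real j)\<^sup>2) * K j) = (1 - \<alpha>) / 2 * poly p 0)"
    (is "_ \<longleftrightarrow> ?R")
proof
  assume K: "solves_system q \<alpha> K"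
  show ?R
  proof (intro allI impI)
    fix p :: "real poly"
    assume p: "degree p < q"
    \<comment> \<open>The convention \<open>0 ^ 0 = 1\<close> merges the inhomogeneous equation
      (\<open>i = 0\<close>) with the homogeneous ones.\<close>
    have moment: "(\<Sum>j=1..q. ((real j)\<^sup>2) ^ i * K j) = (1 - \<alpha>) / 2 * 0 ^ i" if "i \<le> degree p" for i
      using K p that by (cases "i = 0") (auto simp: solves_system_def simp flip: power_mult)
    have "(\<Sum>j=1..q. poly p ((real j)\<^sup>2) * K j)
        = (\<Sum>i\<le>degree p. coeff p i * (\<Sum>j=1..q. ((real j)\<^sup>2) ^ i * K j))"
      by (simp add: poly_altdef sum_distrib_left sum_distrib_right mult.assoc)
         (rule sum.swap)
    also have "\<dots> = (1 - \<alpha>) / 2 * poly p 0"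
      unfolding poly_altdef sum_distrib_left[of _ _ "{..degree p}"]
      by (intro sum.cong refl) (simp add: moment del: One_nat_def)
    finally show "(\<Sum>j=1..q. poly p ((real j)\<^sup>2) * K j) = (1 - \<alpha>) / 2 * poly p 0" .
  qed
next
  assume R: ?R
  have moment: "(\<Sum>j=1..q. real j ^ (2 * r) * K j) = (1 - \<alpha>) / 2 * 0 ^ r" if "r < q" for r
    using R[rule_format, of "monom 1 r"] that
    by (simp add: degree_monom_eq poly_monom power_mult)
  show "solves_system q \<alpha> K"
    unfolding solves_system_def
  proof (intro conjI ballI)
    show "(\<Sum>j=1..q. K j) = (1 - \<alpha>) / 2"
      using moment[of 0] assms by simp
    show "(\<Sum>j=1..q. real j ^ (2 * r) * K j) = 0" if "r \<in> {1..q - 1}" for r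
    proof -
      have "r < q" "r \<noteq> 0"
        using that by auto
      then show ?thesis
        using moment[of r] by (simp add: zero_power)
    qed
  qed
qed

text \<open>Each induction step adds the two equal terms at \<open>int (Suc q)\<close> and its
  negative.\<close>

lemma sum_symmetric_interval:
  fixes f :: "int \<Rightarrow> 'a::comm_semiring_1"
  assumes "\<And>j. f (- j) = f j"
  shows "(\<Sum>j=-int q..int q. f j) = f 0 + 2 * (\<Sum>j=1..q. f (int j))"
proof (induction q)
  case (Suc q)
  have "{- int (Suc q)..int (Suc q)} = insert (- int (Suc q)) (insert (int (Suc q)) {- int q..int q})"
    by auto
  with Suc assms[of "int (Suc q)"] show ?case
    by (simp add: algebra_simps mult_2)
qed simp

theorem theorem2:
  fixes q :: nat and \<alpha> :: real
  assumes "q \<ge> 1" and "\<alpha> \<noteq> 1"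
  shows "solves_system q \<alpha> (solution q \<alpha>)
    \<and> (\<forall>K. solves_system q \<alpha> K \<longrightarrow> (\<forall>j\<in>{1..q}. K j = solution q \<alpha> j))
    \<and> (\<Sum>j=-int q..int q. real_of_int j ^ (2 * q) * symmetric_extension \<alpha> (solution q \<alpha>) j)
        = (1 - \<alpha>) * (fact q)\<^sup>2 * (-1) ^ (q + 1)
    \<and> (1 - \<alpha>) * (fact q)\<^sup>2 * (-1) ^ (q + 1) \<noteq> 0"
proof (intro conjI allI impI ballI)
  define x :: "nat \<Rightarrow> real" where "x = (\<lambda>j. (real j)\<^sup>2)"
  define L where "L = lagrange_basis {1..q} x"
  have inj: "inj_on x {1..q}"
    unfolding x_def by (rule inj_on_real_square)
  have solution: "solution q \<alpha> j = (1 - \<alpha>) / 2 * poly (L j) 0" if "j \<in> {1..q}" for j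
    using solution_eq_lagrange_basis[OF that] by (simp add: L_def x_def)
  \<comment> \<open>Stated for arbitrary \<open>f\<close> because it serves both polynomials of
    degree below \<open>q\<close> and the power \<open>x j ^ q\<close>.\<close>
  have functional: "(\<Sum>j=1..q. f j * solution q \<alpha> j) = (1 - \<alpha>) / 2 * (\<Sum>j=1..q. f j * poly (L j) 0)"
    for f :: "nat \<Rightarrow> real"
    unfolding sum_distrib_left by (intro sum.cong refl) (simp add: solution)
  show "solves_system q \<alpha> (solution q \<alpha>)"
    unfolding solves_system_iff[OF assms(1)] functional
    using lagrange_interpolation[of "{1..q}" x _ 0] inj by (simp add: L_def x_def)
  show "K j = solution q \<alpha> j" if K: "solves_system q \<alpha> K" and j: "j \<in> {1..q}" for K j
  proof -
    \<comment> \<open>Testing \<open>K\<close> against \<open>L j\<close>, which is 1 at node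
      \<open>j\<close> and 0 at the others, isolates \<open>K j\<close>.\<close>
    have "(1 - \<alpha>) / 2 * poly (L j) 0 = (\<Sum>k=1..q. poly (L j) (x k) * K k)"
      using K degree_lagrange_basis[of "{1..q}" j x] j
      unfolding solves_system_iff[OF assms(1)] L_def x_def by simp
    also have "\<dots> = (\<Sum>k=1..q. if j = k then K k else 0)"
      using poly_lagrange_basis_node[OF _ inj j] by (intro sum.cong refl) (simp add: L_def)
    also have "\<dots> = K j"
      using j by simp
    finally show ?thesis
      using solution[OF j] by simp
  qed
  \<comment> \<open>The central term \<open>\<alpha>\<close> drops out, since its weight
    \<open>0 ^ (2 * q)\<close> is 0 for \<open>q \<ge> 1\<close>.\<close>
  have "(\<Sum>j=-int q..int q. real_of_int j ^ (2 * q) * symmetric_extension \<alpha> (solution q \<alpha>) j)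
      = 2 * (\<Sum>j=1..q. x j ^ q * solution q \<alpha> j)"
    using assms(1)
    by (subst sum_symmetric_interval) (auto simp: symmetric_extension_def x_def power_mult intro!: sum.cong)
  also have "\<dots> = (1 - \<alpha>) * (\<Sum>j=1..q. x j ^ q * poly (L j) 0)"
    unfolding functional by simp
  also have "(\<Sum>j=1..q. x j ^ q * poly (L j) 0) = - (\<Prod>l=1..q. - x l)"
    using lagrange_interpolation_monomial_card[of "{1..q}" x 0] inj assms(1) by (simp add: L_def)
  also have "(\<Prod>l=1..q. - x l) = (-1) ^ q * (fact q)\<^sup>2"
    by (simp add: x_def prod_uminus fact_prod prod_power_distrib)
  finally show "(\<Sum>j=-int q..int q. real_of_int j ^ (2 * q) * symmetric_extension \<alpha> (solution q \<alpha>) j)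
      = (1 - \<alpha>) * (fact q)\<^sup>2 * (-1) ^ (q + 1)"
    by simp
  show "(1 - \<alpha>) * (fact q)\<^sup>2 * (-1) ^ (q + 1) \<noteq> 0"
    using assms(2) by simp
qed

end
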